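(* Fix a prime $p>n$ and a positive integer $\ell$. Let $\Phi=(\phi_j)_{j=1}^n$ be an $(a,1)$-equiangular system of $n$ vectors which is also a frame for a $d$-dimensional orthogonal space $V$ over $\mathbb{F}_{p^\ell}$, such that $n>d$ and the two-graph induced by $\Phi$ is non-trivial. Then there exists $c\in\mathbb{F}_{p^\ell}$ such that $\Phi$ is an $(a,1,c)$-equiangular tight frame for $V$ if and only if the induced two-graph is regular.
   Context: An orthogonal space over $\mathbb{F}=\mathbb{F}_{p^\ell}$ ($p$ odd) is a finite-dimensional $\mathbb{F}$-vector space with a non-degenerate symmetric bilinear form $\langle\cdot,\cdot\rangle$. A frame for $V$ is a sequence spanning $V$; its synthesis operator $\Phi:\mathbb{F}^n\to V$, $x\mapsto\sum_jx_j\phi_j$, has adjoint $\Phi^\dagger v=(\langle\phi_j,v\rangle)_j$ ($\mathbb{F}^n$ with the dot product), and $\Phi$ is a $c$-tight frame if $\Phi\Phi^\dagger=cI$. $\Phi$ is $(a,b)$-equiangular if $\langle\phi_j,\phi_j\rangle=a$ for all $j$ and $\langle\phi_j,\phi_k\rangle^2=b$ for $j\neq k$; an $(a,b,c)$-equiangular tight frame for $V$ is an $(a,b)$-equiangular $c$-tight frame for $V$. A two-graph on a finite set $\Omega$ is a family $\mathcal{B}$ of 3-element subsets (coherent triples) such that every 4-element subset of $\Omega$ contains an even number of members of $\mathcal{B}$; it is regular if every 2-element subset of $\Omega$ lies in the same number of coherent triples, and trivial if $\mathcal{B}=\emptyset$. The two-graph induced by an $(a,1)$-equiangular system $\Phi$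 in an orthogonal space has point set $[n]$ and coherent triples the sets $\{j,k,m\}$ of distinct indices with $\langle\phi_j,\phi_k\rangle\langle\phi_k,\phi_m\rangle\langle\phi_m,\phi_j\rangle=-1$. *)

theory Defs
  imports "HOL-Analysis.Finite_Cartesian_Product" "HOL-Computational_Algebra.Primes"
begin

text \<open>
  The space is the whole type \<open>'v\<close> with scalar multiplication \<open>smul\<close>. A sequence of \<open>n\<close> vectors
  is a function on a finite index type \<open>'n\<close> with \<open>CARD('n) = n\<close>, so that \<open>'f ^ 'n\<close> is the
  coordinate space of dimension \<open>n\<close>.
\<close>

locale orthogonal_space = vector_space smul
  for smul :: "'f::{field,finite} \<Rightarrow> 'v::ab_group_add \<Rightarrow> 'v" +
  fixes form :: "'v \<Rightarrow> 'v \<Rightarrow> 'f"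
  assumes finite_dim: "\<exists>B. finite B \<and> span B = UNIV"
    and linear_left: "Vector_Spaces.linear smul (*) (\<lambda>u. form u v)"
    and linear_right: "Vector_Spaces.linear smul (*) (\<lambda>v. form u v)"
    and symmetric: "form u v = form v u"
    and nondegenerate: "(\<And>v. form u v = 0) \<Longrightarrow> u = 0"

definition frame :: "('f::field \<Rightarrow> 'v::ab_group_add \<Rightarrow> 'v) \<Rightarrow> ('n::finite \<Rightarrow> 'v) \<Rightarrow> bool" where
  "frame smul \<phi> \<longleftrightarrow> module.span smul (range \<phi>) = UNIV"

definition synthesis ::
  "('f::field \<Rightarrow> 'v::ab_group_add \<Rightarrow> 'v) \<Rightarrow> ('n::finite \<Rightarrow> 'v) \<Rightarrow> 'f ^ 'n \<Rightarrow> 'v" where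
  "synthesis smul \<phi> x = (\<Sum>j\<in>UNIV. smul (x $ j) (\<phi> j))"

text \<open>The adjoint of \<open>synthesis\<close> with respect to the dot product on \<open>'f ^ 'n\<close>.\<close>

definition analysis :: "('v \<Rightarrow> 'v \<Rightarrow> 'f::field) \<Rightarrow> ('n::finite \<Rightarrow> 'v) \<Rightarrow> 'v \<Rightarrow> 'f ^ 'n" where
  "analysis form \<phi> v = (\<chi> j. form (\<phi> j) v)"

definition tight_frame ::
  "('f::field \<Rightarrow> 'v::ab_group_add \<Rightarrow> 'v) \<Rightarrow> ('v \<Rightarrow> 'v \<Rightarrow> 'f) \<Rightarrow> 'f \<Rightarrow> ('n::finite \<Rightarrow> 'v) \<Rightarrow> bool" where
  "tight_frame smul form c \<phi> \<longleftrightarrow>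
     frame smul \<phi> \<and> synthesis smul \<phi> \<circ> analysis form \<phi> = smul c"

definition equiangular ::
  "('v \<Rightarrow> 'v \<Rightarrow> 'f::field) \<Rightarrow> 'f \<Rightarrow> 'f \<Rightarrow> ('n::finite \<Rightarrow> 'v) \<Rightarrow> bool" where
  "equiangular form a b \<phi> \<longleftrightarrow>
     (\<forall>j. form (\<phi> j) (\<phi> j) = a) \<and> (\<forall>j k. j \<noteq> k \<longrightarrow> (form (\<phi> j) (\<phi> k))\<^sup>2 = b)"

definition equiangular_tight_frame ::
  "('f::field \<Rightarrow> 'v::ab_group_add \<Rightarrow> 'v) \<Rightarrow> ('v \<Rightarrow> 'v \<Rightarrow> 'f) \<Rightarrow> 'f \<Rightarrow> 'f \<Rightarrow> 'f \<Rightarrow>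
    ('n::finite \<Rightarrow> 'v) \<Rightarrow> bool" where
  "equiangular_tight_frame smul form a b c \<phi> \<longleftrightarrow>
     equiangular form a b \<phi> \<and> tight_frame smul form c \<phi>"

definition two_graph :: "'a set \<Rightarrow> 'a set set \<Rightarrow> bool" where
  "two_graph \<Omega> \<B> \<longleftrightarrow> finite \<Omega> \<and> (\<forall>T\<in>\<B>. T \<subseteq> \<Omega> \<and> card T = 3) \<and>
     (\<forall>Q. Q \<subseteq> \<Omega> \<and> card Q = 4 \<longrightarrow> even (card {T \<in> \<B>. T \<subseteq> Q}))"

definition regular_two_graph :: "'a set \<Rightarrow> 'a set set \<Rightarrow> bool" where
  "regular_two_graph \<Omega> \<B> \<longleftrightarrow> two_graph \<Omega> \<B> \<and>
     (\<exists>r. \<forall>P. P \<subseteq> \<Omega> \<and> card P = 2 \<longrightarrow> card {T \<in> \<B>. P \<subseteq> T} = r)"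

definition trivial_two_graph :: "'a set set \<Rightarrow> bool" where
  "trivial_two_graph \<B> \<longleftrightarrow> \<B> = {}"

definition induced_two_graph :: "('v \<Rightarrow> 'v \<Rightarrow> 'f::field) \<Rightarrow> ('n::finite \<Rightarrow> 'v) \<Rightarrow> 'n set set" where
  "induced_two_graph form \<phi> =
     {{j, k, m} | j k m. j \<noteq> k \<and> k \<noteq> m \<and> m \<noteq> j \<and>
        form (\<phi> j) (\<phi> k) * form (\<phi> k) (\<phi> m) * form (\<phi> m) (\<phi> j) = -1}"

end

theory Submission imports Defs begin

text \<open>
  Write \<open>s j k\<close> for the entries of the Gram matrix \<open>G\<close>. For \<open>j \<noteq> k\<close>, multiplying the
  \<open>(j, k)\<close> entry of \<open>G\<^sup>2\<close> by \<open>s j k = \<plusminus>1\<close> gives \<open>2 a + (n - 2) - 2 r\<close>, where \<open>r\<close> counts the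
  coherent triples containing \<open>{j, k}\<close>. Tightness says \<open>G\<^sup>2 = c G\<close>, so it fixes \<open>r\<close> modulo \<open>p\<close>,
  hence fixes \<open>r\<close>, as \<open>r < p\<close>. Conversely, regularity yields \<open>G\<^sup>2 = c G + \<delta> I\<close> for some
  \<open>c\<close> and \<open>\<delta>\<close>. As \<open>n > d\<close>, the matrix \<open>G\<close> is singular, and evaluating at a kernel vector gives
  \<open>\<delta> = 0\<close>.
\<close>

section \<open>Natural numbers below \<open>p\<close> inside a field of order
  \<open>p ^ l\<close>\<close>

lemma of_nat_eq_0_below_prime:
  assumes "prime p" and "CARD('f::{field,finite}) = p ^ l"
    and "of_nat k = (0::'f)" and "k < p"
  shows "k = 0"
proof (rule ccontr)
  assume "k \<noteq> 0"
  \<comment> \<open>Translation by 1 permutes the finite field. Cancelling the sum of all elements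
    leaves the order of the field, a power of \<open>p\<close>, equal to 0 in the field.\<close>
  have "(\<Sum>x\<in>UNIV. x + 1) = (\<Sum>x\<in>(UNIV::'f set). x)"
    by (rule sum.reindex_bij_witness[of _ "\<lambda>x. x - 1" "\<lambda>x. x + 1"]) auto
  then have "of_nat CARD('f) = (0::'f)"
    by (simp add: sum.distrib)
  then have p0: "of_nat p = (0::'f)"
    using assms(2) by simp
  have "coprime k p"
    using \<open>k \<noteq> 0\<close> \<open>k < p\<close> \<open>prime p\<close>
    by (metis coprime_commute nat_dvd_not_less not_gr_zero prime_imp_coprime)
  \<comment> \<open>With both \<open>k\<close> and \<open>p\<close> mapped to 0, this Bezout
    identity reads 0 = 1 in the field.\<close>
  then obtain x y where "k * x = p * y + 1"
    using bezout_nat[OF \<open>k \<noteq> 0\<close>, of p] by (auto simp: coprime_iff_gcd_eq_1)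
  then have "of_nat k * of_nat x = (of_nat p * of_nat y + 1 :: 'f)"
    by (metis of_nat_1 of_nat_add of_nat_mult)
  then show False
    using p0 assms(3) by simp
qed

lemma of_nat_inj_below_prime:
  assumes "prime p" and "CARD('f::{field,finite}) = p ^ l"
    and "of_nat i = (of_nat j :: 'f)" and "i < p" and "j < p"
  shows "i = j"
  using assms
proof (induction i j rule: linorder_wlog)
  case (le i j)
  then have "of_nat (j - i) = (0::'f)"
    by (simp add: of_nat_diff)
  then have "j - i = 0"
    using le(6) by (intro of_nat_eq_0_below_prime[OF le(2,3)]) simp_all
  then show ?case
    using le(1) by simp
next
  case (sym i j)
  then show ?case
    by metis
qed

section \<open>The form, the frame operator and the kernel of the synthesis map\<close>

context orthogonal_space
begin

lemma form_sum_right: "form u (\<Sum>j\<in>A. smul (x j) (\<phi> j)) = (\<Sum>j\<in>A. x j * form u (\<phi> j))"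
proof -
  interpret Vector_Spaces.linear smul "(*)" "form u"
    by (rule linear_right)
  show ?thesis
    by (simp add: sum scale)
qed

lemma form_scale_right: "form u (smul c v) = c * form u v"
  using form_sum_right[of u "\<lambda>_. c" "\<lambda>_. v" "{()}"] by simp

lemma form_zero_right: "form u 0 = 0"
  using form_scale_right[of u 0 0] by simp

lemma form_diff_right: "form u (v - w) = form u v - form u w"
proof -
  interpret Vector_Spaces.linear smul "(*)" "form u"
    by (rule linear_right)
  show ?thesis
    by (rule diff)
qed

text \<open>The functional \<open>form v\<close> vanishes on a spanning set, hence everywhere, and
  the form is non-degenerate.\<close>

lemma eq_0_if_orthogonal_to_frame:
  assumes "frame smul \<phi>" and "\<And>j. form (\<phi> j) v = 0"
  shows "v = 0"
proof (rule nondegenerate)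
  fix w
  interpret Vector_Spaces.linear smul "(*)" "form v"
    by (rule linear_right)
  have "w \<in> span (range \<phi>)"
    using assms(1) by (simp add: frame_def)
  then show "form v w = 0"
    by (rule eq_0_on_span[rotated]) (use assms(2) symmetric in auto)
qed

text \<open>Pairings with the frame vectors determine a vector, so \<open>G\<^sup>2 = c G\<close>
  makes the frame operator act as \<open>c\<close> on every \<open>\<phi> j\<close>;
  self-adjointness then carries this over to every \<open>v\<close>.\<close>

lemma synthesis_analysis_eq_scaleI:
  fixes \<phi> :: "'n::finite \<Rightarrow> 'v"
  assumes frame: "frame smul \<phi>"
    and gram: "\<And>j k. (\<Sum>m\<in>UNIV. form (\<phi> j) (\<phi> m) * form (\<phi> m) (\<phi> k)) = c * form (\<phi> j) (\<phi> k)"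
  shows "synthesis smul \<phi> \<circ> analysis form \<phi> = smul c"
proof
  fix v
  have "form (\<phi> i) ((\<Sum>m\<in>UNIV. smul (form (\<phi> m) (\<phi> j)) (\<phi> m)) - smul c (\<phi> j)) = 0" for i j
    using gram[of i j]
    by (simp add: form_diff_right form_scale_right form_sum_right mult.commute)
  then have "(\<Sum>m\<in>UNIV. smul (form (\<phi> m) (\<phi> j)) (\<phi> m)) - smul c (\<phi> j) = 0" for j
    by (rule eq_0_if_orthogonal_to_frame[OF frame])
  then have adj: "form v (\<Sum>m\<in>UNIV. smul (form (\<phi> m) (\<phi> j)) (\<phi> m)) = form v (smul c (\<phi> j))" for j
    by simp
  have "(\<Sum>m\<in>UNIV. form (\<phi> j) (\<phi> m) * form (\<phi> m) v) = c * form (\<phi> j) v" for j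
    using adj[of j]
    by (simp add: form_sum_right form_scale_right symmetric[of v] symmetric[of _ "\<phi> j"])
  then have "form (\<phi> j) (synthesis smul \<phi> (analysis form \<phi> v) - smul c v) = 0" for j
    by (simp add: synthesis_def analysis_def form_diff_right form_scale_right form_sum_right
        mult.commute)
  then have "synthesis smul \<phi> (analysis form \<phi> v) - smul c v = 0"
    by (rule eq_0_if_orthogonal_to_frame[OF frame])
  then show "(synthesis smul \<phi> \<circ> analysis form \<phi>) v = smul c v"
    by simp
qed

text \<open>Linear dependence of the set \<open>range \<phi>\<close> does not see repetitions. A
  repeated vector therefore gets its own kernel element, with coordinates 1 and -1; for injective
  \<open>\<phi>\<close> the set has more elements than the dimension.\<close>

lemma synthesis_not_injective:
  fixes \<phi> :: "'n::finite \<Rightarrow> 'v"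
  assumes "frame smul \<phi>" and "dim (UNIV :: 'v set) < CARD('n)"
  obtains x i where "synthesis smul \<phi> x = 0" and "x $ i \<noteq> 0"
proof (cases "inj \<phi>")
  case False
  then obtain i j where ij: "i \<noteq> j" "\<phi> i = \<phi> j"
    by (auto simp: inj_def)
  let ?x = "(\<chi> m. if m = i then 1 else if m = j then - 1 else 0) :: 'f ^ 'n"
  have "synthesis smul \<phi> ?x = (\<Sum>m\<in>{i, j}. smul (?x $ m) (\<phi> m))"
    unfolding synthesis_def by (rule sum.mono_neutral_right) auto
  also have "\<dots> = 0"
    using ij by simp
  finally show thesis
    using that[of ?x i] by simp
next
  case True
  have "card (range \<phi>) = CARD('n)"
    using True by (simp add: card_image)
  moreover have "dim (UNIV :: 'v set) = dim (range \<phi>)"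
    using assms(1) by (metis frame_def dim_span)
  ultimately have "dependent (range \<phi>)"
    using assms(2) dim_eq_card_independent by fastforce
  then obtain u i where u: "(\<Sum>v\<in>range \<phi>. smul (u v) v) = 0" "u (\<phi> i) \<noteq> 0"
    by (auto simp: dependent_finite)
  have "synthesis smul \<phi> (\<chi> m. u (\<phi> m)) = 0"
    using u(1) True by (simp add: synthesis_def sum.reindex)
  then show thesis
    using that[of "\<chi> m. u (\<phi> m)" i] u(2) by simp
qed

section \<open>The induced two-graph and its pair degrees\<close>

lemma triple_in_induced_two_graph_iff:
  assumes "j \<noteq> k" "k \<noteq> m" "m \<noteq> j"
  shows "{j, k, m} \<in> induced_two_graph form \<phi> \<longleftrightarrow>
    form (\<phi> j) (\<phi> k) * form (\<phi> k) (\<phi> m) * form (\<phi> m) (\<phi> j) = -1"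
proof
  assume "{j, k, m} \<in> induced_two_graph form \<phi>"
  then obtain j' k' m' where eq: "{j, k, m} = {j', k', m'}"
    and d: "j' \<noteq> k'" "k' \<noteq> m'" "m' \<noteq> j'"
    and t: "form (\<phi> j') (\<phi> k') * form (\<phi> k') (\<phi> m') * form (\<phi> m') (\<phi> j') = -1"
    unfolding induced_two_graph_def by blast
  from eq have "j' \<in> {j, k, m}" "k' \<in> {j, k, m}" "m' \<in> {j, k, m}"
    by auto
  then show "form (\<phi> j) (\<phi> k) * form (\<phi> k) (\<phi> m) * form (\<phi> m) (\<phi> j) = -1"
    using d t
    by (elim insertE emptyE)
      (simp_all add: symmetric[of "\<phi> k" "\<phi> j"] symmetric[of "\<phi> m" "\<phi> k"]
        symmetric[of "\<phi> m" "\<phi> j"] mult_ac)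
qed (use assms in \<open>auto simp: induced_two_graph_def\<close>)

lemma equiangular_form_cases:
  assumes "equiangular form a 1 \<phi>" and "j \<noteq> k"
  shows "form (\<phi> j) (\<phi> k) = 1 \<or> form (\<phi> j) (\<phi> k) = -1"
  using assms by (auto simp: equiangular_def power2_eq_1_iff)

text \<open>In the product of the triple signs over the four 3-subsets of \<open>Q\<close>, each of
  the six pairings occurs twice. The product is thus 1, and the number of factors -1 is even because
  1 and -1 differ.\<close>

lemma two_graph_induced_two_graph:
  fixes \<phi> :: "'n::finite \<Rightarrow> 'v"
  assumes eq: "equiangular form a 1 \<phi>" and char: "(1::'f) \<noteq> -1"
  shows "two_graph UNIV (induced_two_graph form \<phi>)" (is "two_graph _ ?B")
  unfolding two_graph_def
proof (intro conjI ballI allI impI)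
  fix T assume "T \<in> ?B"
  then show "card T = 3"
    by (auto simp: induced_two_graph_def)
next
  fix Q :: "'n set" assume Q: "Q \<subseteq> UNIV \<and> card Q = 4"
  then obtain w x y z where Q_eq: "Q = {w, x, y, z}" and dist: "distinct [w, x, y, z]"
    by (auto simp: card_Suc_eq numeral_eq_Suc)
  have card3: "card T = 3" if "T \<in> ?B" for T
    using that by (auto simp: induced_two_graph_def)
  \<comment> \<open>A 3-subset of \<open>Q\<close> is indexed by the one point that it
    omits.\<close>
  have "{T \<in> ?B. T \<subseteq> Q} = (\<lambda>q. Q - {q}) ` {q \<in> Q. Q - {q} \<in> ?B}"
  proof (intro equalityI subsetI)
    fix T assume T: "T \<in> {T \<in> ?B. T \<subseteq> Q}"
    then have "card (Q - T) = 1"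
      using Q card3 by (simp add: card_Diff_subset)
    then obtain q where "Q - T = {q}"
      by (auto simp: card_1_singleton_iff)
    then have "T = Q - {q}" "q \<in> Q"
      using T by auto
    then show "T \<in> (\<lambda>q. Q - {q}) ` {q \<in> Q. Q - {q} \<in> ?B}"
      using T by auto
  qed auto
  moreover have "inj_on (\<lambda>q. Q - {q}) {q \<in> Q. Q - {q} \<in> ?B}"
    by (auto simp: inj_on_def)
  ultimately have card_eq: "card {T \<in> ?B. T \<subseteq> Q} = card {q \<in> Q. Q - {q} \<in> ?B}"
    by (simp add: card_image)
  have "(-1) ^ card {q \<in> Q. Q - {q} \<in> ?B} = (\<Prod>q\<in>Q. if Q - {q} \<in> ?B then -1 else 1 :: 'f)"
    by (simp add: prod.If_cases Int_def)
  also have "\<dots> = 1"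
  proof -
    have "Q - {w} = {x, y, z}" "Q - {x} = {w, y, z}" "Q - {y} = {w, x, z}" "Q - {z} = {w, x, y}"
      using Q_eq dist by auto
    moreover have "(if {i, j, k} \<in> ?B then -1 else 1) =
        form (\<phi> i) (\<phi> j) * form (\<phi> j) (\<phi> k) * form (\<phi> i) (\<phi> k)"
      if "i \<noteq> j" "j \<noteq> k" "i \<noteq> k" for i j k
      using equiangular_form_cases[OF eq that(1)] equiangular_form_cases[OF eq that(2)]
        equiangular_form_cases[OF eq that(3)] that char
      by (elim disjE) (simp_all add: triple_in_induced_two_graph_iff symmetric[of "\<phi> k" "\<phi> i"])
    \<comment> \<open>This and the next fact cancel squared pairings once \<open>mult_ac\<close> has
      brought equal factors together.\<close>
    moreover have "form (\<phi> i) (\<phi> j) * (form (\<phi> i) (\<phi> j) * c) = c" if "i \<noteq> j" for i j c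
      using equiangular_form_cases[OF eq that] by auto
    moreover have "form (\<phi> i) (\<phi> j) * form (\<phi> i) (\<phi> j) = 1" if "i \<noteq> j" for i j
      using equiangular_form_cases[OF eq that] by auto
    ultimately show ?thesis
      using dist by (simp add: Q_eq mult_ac)
  qed
  finally show "even (card {T \<in> ?B. T \<subseteq> Q})"
    using char card_eq by (metis uminus_power_if power_one)
qed simp_all

lemma card_coherent_triples_containing_pair:
  fixes \<phi> :: "'n::finite \<Rightarrow> 'v"
  assumes "j \<noteq> k"
  shows "card {T \<in> induced_two_graph form \<phi>. {j, k} \<subseteq> T} =
    card {m. m \<noteq> j \<and> m \<noteq> k \<and> form (\<phi> j) (\<phi> k) * form (\<phi> k) (\<phi> m) * form (\<phi> m) (\<phi> j) = -1}"
    (is "card {T \<in> ?B. _} = card ?M")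
proof -
  have "{T \<in> ?B. {j, k} \<subseteq> T} = (\<lambda>m. {j, k, m}) ` ?M"
  proof (intro equalityI subsetI)
    fix T assume T: "T \<in> {T \<in> ?B. {j, k} \<subseteq> T}"
    then have "card T = 3"
      by (auto simp: induced_two_graph_def)
    then have "card (T - {j, k}) = 1"
      using T assms by (simp add: card_Diff_subset)
    then obtain m where "T - {j, k} = {m}"
      by (auto simp: card_1_singleton_iff)
    then have m: "T = {j, k, m}" "m \<noteq> j" "m \<noteq> k"
      using T by auto
    then have "m \<in> ?M"
      using T triple_in_induced_two_graph_iff[of j k m \<phi>] assms by auto
    then show "T \<in> (\<lambda>m. {j, k, m}) ` ?M"
      using m(1) by auto
  qed (use assms triple_in_induced_two_graph_iff[of j k] in auto)
  moreover have "inj_on (\<lambda>m. {j, k, m}) ?M"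
    by (auto simp: inj_on_def)
  ultimately show ?thesis
    by (simp add: card_image)
qed

text \<open>The terms \<open>m = j\<close> and \<open>m = k\<close> each contribute
  \<open>a\<close>, since the pairing of the two vectors squares to 1. The remaining
  \<open>CARD('n) - 2\<close> terms are signs, and coherence marks those equal to -1.\<close>

lemma sum_triple_products:
  fixes \<phi> :: "'n::finite \<Rightarrow> 'v"
  assumes eq: "equiangular form a 1 \<phi>" and "j \<noteq> k"
  shows "(\<Sum>m\<in>UNIV. form (\<phi> j) (\<phi> k) * form (\<phi> k) (\<phi> m) * form (\<phi> m) (\<phi> j)) =
    2 * a + of_nat (CARD('n) - 2)
      - 2 * of_nat (card {T \<in> induced_two_graph form \<phi>. {j, k} \<subseteq> T})"
proof -
  let ?t = "\<lambda>m. form (\<phi> j) (\<phi> k) * form (\<phi> k) (\<phi> m) * form (\<phi> m) (\<phi> j)"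
  let ?R = "UNIV - {j, k}"
  have sq: "form (\<phi> j) (\<phi> k) * form (\<phi> j) (\<phi> k) = 1"
    using eq \<open>j \<noteq> k\<close> by (simp add: equiangular_def power2_eq_square)
  have t_jk: "?t j = a" "?t k = a"
    using eq sq by (auto simp: equiangular_def symmetric[of "\<phi> k" "\<phi> j"] mult_ac)
  \<comment> \<open>Writing a sign through the indicator of -1 turns the sum into a count.\<close>
  have "?t m = 1 - 2 * (if ?t m = -1 then 1 else 0)" if "m \<in> ?R" for m
    using that \<open>j \<noteq> k\<close> equiangular_form_cases[OF eq, of j k]
      equiangular_form_cases[OF eq, of k m] equiangular_form_cases[OF eq, of m j]
    by auto
  then have "(\<Sum>m\<in>?R. ?t m) = (\<Sum>m\<in>?R. 1 - 2 * (if ?t m = -1 then 1 else 0))"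
    by (rule sum.cong[OF refl])
  also have "\<dots> = of_nat (CARD('n) - 2) - 2 * of_nat (card {m \<in> ?R. ?t m = -1})"
    using \<open>j \<noteq> k\<close>
    by (simp add: numeral_2_eq_2 sum_subtractf card_Diff_subset sum.If_cases Int_def
        flip: sum_distrib_left)
  also have "{m \<in> ?R. ?t m = -1} = {m. m \<noteq> j \<and> m \<noteq> k \<and> ?t m = -1}"
    by auto
  also have "card \<dots> = card {T \<in> induced_two_graph form \<phi>. {j, k} \<subseteq> T}"
    by (rule card_coherent_triples_containing_pair[OF \<open>j \<noteq> k\<close>, symmetric])
  finally have rest: "(\<Sum>m\<in>?R. ?t m) = of_nat (CARD('n) - 2)
      - 2 * of_nat (card {T \<in> induced_two_graph form \<phi>. {j, k} \<subseteq> T})" .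
  have "(\<Sum>m\<in>UNIV. ?t m) = (\<Sum>m\<in>{j, k}. ?t m) + (\<Sum>m\<in>?R. ?t m)"
    by (metis (no_types, lifting) finite_class.finite_UNIV subset_UNIV sum.subset_diff add.commute)
  then show ?thesis
    using rest t_jk \<open>j \<noteq> k\<close> by simp
qed

section \<open>The two implications\<close>

lemma tight_frame_imp_regular:
  fixes \<phi> :: "'n::finite \<Rightarrow> 'v"
  assumes p: "prime p" "odd p" "CARD('n) < p" "CARD('f) = p ^ l"
    and eq: "equiangular form a 1 \<phi>" and tight: "tight_frame smul form c \<phi>"
  shows "regular_two_graph UNIV (induced_two_graph form \<phi>)"
proof -
  let ?r = "\<lambda>P. card {T \<in> induced_two_graph form \<phi>. P \<subseteq> T}"
  \<comment> \<open>Invertibility of 2 serves twice: it separates 1 from -1, and it cancels the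
    factor in front of the pair degree.\<close>
  have "2 < p"
    using p(1,2) by (metis even_numeral le_neq_implies_less prime_ge_2_nat)
  then have two: "(2::'f) \<noteq> 0"
    using of_nat_eq_0_below_prime[OF p(1,4), of 2] by auto
  then have char: "(1::'f) \<noteq> -1"
    by (metis add.right_inverse one_add_one)
  \<comment> \<open>Tightness is evaluated at \<open>\<phi> k\<close>, paired with
    \<open>\<phi> j\<close> and multiplied by the sign
    \<open>form (\<phi> j) (\<phi> k)\<close>.\<close>
  have c_eq: "c = 2 * a + of_nat (CARD('n) - 2) - 2 * of_nat (?r {j, k})" if "j \<noteq> k" for j k
  proof -
    have "(\<Sum>m\<in>UNIV. smul (form (\<phi> m) (\<phi> k)) (\<phi> m)) = smul c (\<phi> k)"
      using tight by (auto simp: tight_frame_def synthesis_def analysis_def fun_eq_iff)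
    then have "form (\<phi> j) (\<Sum>m\<in>UNIV. smul (form (\<phi> m) (\<phi> k)) (\<phi> m)) = form (\<phi> j) (smul c (\<phi> k))"
      by simp
    then have "(\<Sum>m\<in>UNIV. form (\<phi> k) (\<phi> m) * form (\<phi> m) (\<phi> j)) = c * form (\<phi> j) (\<phi> k)"
      by (simp add: form_sum_right form_scale_right symmetric[of "\<phi> k"] symmetric[of _ "\<phi> j"])
    then have "(\<Sum>m\<in>UNIV. form (\<phi> j) (\<phi> k) * form (\<phi> k) (\<phi> m) * form (\<phi> m) (\<phi> j))
        = c * (form (\<phi> j) (\<phi> k))\<^sup>2"
      by (simp add: mult.assoc power2_eq_square mult.left_commute[of c] flip: sum_distrib_left)
    then show ?thesis
      using sum_triple_products[OF eq that] eq that by (simp add: equiangular_def)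
  qed
  \<comment> \<open>The degree counts third points, so it is at most \<open>CARD('n)\<close>; below
    \<open>p\<close>, equality in the field is equality of numbers.\<close>
  have r_less: "?r {j, k} < p" if "j \<noteq> k" for j k
    unfolding card_coherent_triples_containing_pair[OF that]
    by (rule le_less_trans[OF card_mono p(3)]) simp_all
  have r_eq: "?r {j, k} = ?r {j', k'}" if "j \<noteq> k" "j' \<noteq> k'" for j k j' k'
  proof (rule of_nat_inj_below_prime[OF p(1,4)])
    show "of_nat (?r {j, k}) = (of_nat (?r {j', k'}) :: 'f)"
      using c_eq[OF that(1)] c_eq[OF that(2)] two by auto
  qed (use r_less that in auto)
  have "\<exists>r. \<forall>P. P \<subseteq> UNIV \<and> card P = 2 \<longrightarrow> ?r P = r"
  \<comment> \<open>With a single index there are no pairs, and any \<open>r\<close> serves.\<close>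
  proof (cases "\<exists>j k :: 'n. j \<noteq> k")
    case True
    then obtain j k :: 'n where "j \<noteq> k"
      by auto
    have "?r P = ?r {j, k}" if P: "card P = 2" for P
    proof -
      obtain j' k' where "P = {j', k'}" "j' \<noteq> k'"
        using P by (auto simp: card_2_iff)
      then show ?thesis
        using r_eq[OF _ \<open>j \<noteq> k\<close>] by simp
    qed
    then show ?thesis
      by blast
  qed (auto simp: card_2_iff)
  then show ?thesis
    unfolding regular_two_graph_def using two_graph_induced_two_graph[OF eq char] by blast
qed

lemma regular_imp_tight_frame:
  fixes \<phi> :: "'n::finite \<Rightarrow> 'v"
  assumes eq: "equiangular form a 1 \<phi>" and frame: "frame smul \<phi>"
    and dim: "dim (UNIV :: 'v set) < CARD('n)"
    and reg: "regular_two_graph UNIV (induced_two_graph form \<phi>)"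
  shows "\<exists>c. tight_frame smul form c \<phi>"
proof -
  let ?s = "\<lambda>j k. form (\<phi> j) (\<phi> k)"
  obtain r where r: "card {T \<in> induced_two_graph form \<phi>. P \<subseteq> T} = r" if "card P = 2" for P
    using reg by (auto simp: regular_two_graph_def)
  \<comment> \<open>The off-diagonal entries of \<open>G\<^sup>2\<close> dictate \<open>c\<close>;
    \<open>\<delta>\<close> is the error this leaves on the diagonal. With a single index no pair
    constrains \<open>c\<close>, and the argument for \<open>\<delta> = 0\<close> below still
    applies.\<close>
  define c where "c = 2 * a + of_nat (CARD('n) - 2) - 2 * of_nat r"
  define \<delta> where "\<delta> = a\<^sup>2 + of_nat (CARD('n) - 1) - c * a"
  have off_diagonal: "(\<Sum>m\<in>UNIV. ?s j m * ?s m k) = c * ?s j k" if "j \<noteq> k" for j k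
  proof -
    have sq: "?s j k * ?s j k = 1"
      using eq that by (simp add: equiangular_def power2_eq_square)
    have "?s j k * (?s j m * ?s m k) = ?s j k * ?s k m * ?s m j" for m
      by (simp add: symmetric[of "\<phi> k" "\<phi> m"] symmetric[of "\<phi> m" "\<phi> j"] mult_ac)
    then have "?s j k * (\<Sum>m\<in>UNIV. ?s j m * ?s m k)
        = (\<Sum>m\<in>UNIV. ?s j k * ?s k m * ?s m j)"
      unfolding sum_distrib_left by (rule sum.cong[OF refl])
    also have "\<dots> = c"
      using sum_triple_products[OF eq that] r[of "{j, k}"] that by (simp add: c_def)
    \<comment> \<open>A second multiplication by the sign removes it from the left, as it squares to
      1.\<close>
    finally have "?s j k * ?s j k * (\<Sum>m\<in>UNIV. ?s j m * ?s m k) = ?s j k * c"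
      unfolding mult.assoc by (rule arg_cong)
    then show ?thesis
      unfolding sq by (simp add: mult.commute)
  qed
  have diagonal: "(\<Sum>m\<in>UNIV. ?s j m * ?s m j) = c * ?s j j + \<delta>" for j
  proof -
    have "(\<Sum>m\<in>UNIV. ?s j m * ?s m j) = ?s j j * ?s j j + (\<Sum>m\<in>UNIV - {j}. ?s j m * ?s m j)"
      by (simp add: sum.remove)
    also have "(\<Sum>m\<in>UNIV - {j}. ?s j m * ?s m j) = (\<Sum>m\<in>UNIV - {j}. 1)"
      using eq by (intro sum.cong) (auto simp: equiangular_def power2_eq_square symmetric)
    finally show ?thesis
      using eq by (simp add: \<delta>_def equiangular_def power2_eq_square card_Diff_subset)
  qed
  have gram_square: "(\<Sum>m\<in>UNIV. ?s j m * ?s m k) = c * ?s j k + (if j = k then \<delta> else 0)" for j k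
    using off_diagonal diagonal by simp
  obtain x i where x: "synthesis smul \<phi> x = 0" "x $ i \<noteq> 0"
    using synthesis_not_injective[OF frame dim] .
  have ker: "(\<Sum>k\<in>UNIV. x $ k * ?s j k) = 0" for j
    using x(1) form_sum_right[of "\<phi> j" "($) x" \<phi> UNIV] form_zero_right
    by (simp add: synthesis_def)
  \<comment> \<open>Row \<open>i\<close> of \<open>G\<^sup>2 x = c G x + \<delta> x\<close> with
    \<open>G x = 0\<close> leaves \<open>x $ i * \<delta> = 0\<close>, where \<open>x $ i\<close> is
    nonzero.\<close>
  have "0 = (\<Sum>m\<in>UNIV. ?s i m * (\<Sum>k\<in>UNIV. x $ k * ?s m k))"
    by (simp add: ker)
  also have "\<dots> = (\<Sum>k\<in>UNIV. x $ k * (\<Sum>m\<in>UNIV. ?s i m * ?s m k))"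
    unfolding sum_distrib_left by (subst sum.swap) (simp add: mult_ac)
  also have "\<dots> = c * (\<Sum>k\<in>UNIV. x $ k * ?s i k) + x $ i * \<delta>"
  proof -
    have "x $ k * (c * ?s i k + (if i = k then \<delta> else 0)) =
        c * (x $ k * ?s i k) + (if i = k then x $ k * \<delta> else 0)" for k
      by (simp add: distrib_left mult.left_commute)
    then show ?thesis
      by (simp only: gram_square sum.distrib sum.delta' finite_class.finite_UNIV UNIV_I if_True
          flip: sum_distrib_left)
  qed
  finally have "\<delta> = 0"
    using ker x(2) by simp
  then have "synthesis smul \<phi> \<circ> analysis form \<phi> = smul c"
    using gram_square by (intro synthesis_analysis_eq_scaleI[OF frame]) simp
  then show ?thesis
    using frame by (auto simp: tight_frame_def)
qed

end

theorem theorem5p19: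
  fixes smul :: "'f::{field,finite} \<Rightarrow> 'v::ab_group_add \<Rightarrow> 'v"
    and form :: "'v \<Rightarrow> 'v \<Rightarrow> 'f"
    and \<phi> :: "'n::finite \<Rightarrow> 'v"
    and a :: 'f
    and p l n d :: nat
  assumes "prime p" and "odd p" and "p > n" and "l > 0" and "CARD('f) = p ^ l"
    and "orthogonal_space smul form"
    and "vector_space.dim smul (UNIV :: 'v set) = d"
    and "CARD('n) = n"
    and "equiangular form a 1 \<phi>"
    and "frame smul \<phi>"
    and "n > d"
    and "\<not> trivial_two_graph (induced_two_graph form \<phi>)"
  shows "(\<exists>c. equiangular_tight_frame smul form a 1 c \<phi>) \<longleftrightarrow>
         regular_two_graph (UNIV :: 'n set) (induced_two_graph form \<phi>)"
proof -
  interpret orthogonal_space smul form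
    by fact
  show ?thesis
    unfolding equiangular_tight_frame_def
    using tight_frame_imp_regular[of p l a \<phi>] regular_imp_tight_frame[of a \<phi>] assms by blast
qed

end
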